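(* Let the Bessel-like parameters $(\boldsymbol a,\boldsymbol b,\boldsymbol\kappa)$ be regular, with $\kappa_i+a_\rho+1\notin\{0,-1,-2,\dots\}$ for all $i\in\{1,\dots,p\}$, $\rho\in\{1,\dots,r\}$. Then for every $j\in\{1,\dots,q\}$ and $i\in\{1,\dots,p\}$, $$w_{j,i}(z)=\sum_{k=0}^{\infty}\frac{\Gamma((k+\kappa_i)\mathbf 1_r+\boldsymbol a+\mathbf 1_r)}{\Gamma((k+\kappa_i)\mathbf 1_q+\boldsymbol b+\boldsymbol e_j+\mathbf 1_q)}\,z^k ,$$ and each $w_{j,i}$ is an entire function of $z$. Moreover, for every integer $s\ge1$, $$\oint_{\mathbb T}z^{-s}w_{j,i}(z)\frac{\mathrm dz}{2\pi\mathrm i}=\frac{\Gamma((s+\kappa_i)\mathbf 1_r+\boldsymbol a)}{\Gamma((s+\kappa_i)\mathbf 1_q+\boldsymbol b+\boldsymbol e_j)} .$$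
   Context: $\mathbf 1_d$ is the all-ones vector of length $d$, $\boldsymbol e_j$ the $j$-th standard basis vector of $\mathbb C^q$, and for a vector $\boldsymbol v$, $\Gamma(\boldsymbol v)=\prod_h\Gamma(v_h)$ (empty product $=1$); reciprocals $1/\Gamma$ are understood as entire functions. $\mathbb T$ is the positively oriented unit circle. Integers $p,q\ge1$ and $0\le r<q$; parameters $\boldsymbol a\in\mathbb C^r$, $\boldsymbol b\in\mathbb C^q$, $\boldsymbol\kappa\in\mathbb C^p$. They are called regular if $0\le r<q$, $b_j-b_h\notin\mathbb Z$ for $j\ne h$, and $\kappa_i-\kappa_h\notin\mathbb Z$ for $i\ne h$. $f_0(z;\boldsymbol a,\boldsymbol b)=\sum_{k\ge0}\frac{\Gamma(k\mathbf 1_r+\boldsymbol a+\mathbf 1_r)}{\Gamma(k\mathbf 1_q+\boldsymbol b+\mathbf 1_q)}z^k$, and $w_{j,i}(z)=f_0\big(z;\boldsymbol a+\kappa_i\mathbf 1_r,\ \boldsymbol b+\kappa_i\mathbf 1_q+\boldsymbol e_j\big)$ for $1\le j\le q$, $1\le i\le p$. *)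

theory Defs
  imports "HOL-Complex_Analysis.Complex_Analysis" "Jordan_Normal_Form.Matrix"
begin

no_notation Finite_Cartesian_Product.vec_nth (infixl \<open>$\<close> 90)

text \<open>
  Vectors are those of \<^theory>\<open>Jordan_Normal_Form.Matrix\<close>: the dimension is a
  number, which may be 0, and a vector of dimension \<open>d\<close> has the entries \<open>v $ 0, \<dots>, v $ (d - 1)\<close>.
  The indices \<open>\<rho>\<close>, \<open>j\<close>, \<open>i\<close> below hence start at 0 instead of 1.
\<close>

type_synonym cvec = "complex Matrix.vec"

definition ones_vec :: "nat \<Rightarrow> cvec" where
  "ones_vec d = Matrix.vec d (\<lambda>_. 1)"

definition Gamma_vec :: "cvec \<Rightarrow> complex" where
  "Gamma_vec v = (\<Prod>h<dim_vec v. Gamma (v $ h))"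

text \<open>The reciprocal of \<open>Gamma_vec\<close>, with \<open>1 / \<Gamma>\<close> the entire function \<open>rGamma\<close>.\<close>

definition rGamma_vec :: "cvec \<Rightarrow> complex" where
  "rGamma_vec v = (\<Prod>h<dim_vec v. rGamma (v $ h))"

definition regular_params :: "cvec \<Rightarrow> cvec \<Rightarrow> cvec \<Rightarrow> bool" where
  "regular_params a b \<kappa> \<longleftrightarrow>
     dim_vec a < dim_vec b \<and>
     (\<forall>j<dim_vec b. \<forall>h<dim_vec b. j \<noteq> h \<longrightarrow> b $ j - b $ h \<notin> \<int>) \<and>
     (\<forall>i<dim_vec \<kappa>. \<forall>h<dim_vec \<kappa>. i \<noteq> h \<longrightarrow> \<kappa> $ i - \<kappa> $ h \<notin> \<int>)"

definition f0 :: "complex \<Rightarrow> cvec \<Rightarrow> cvec \<Rightarrow> complex" where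
  "f0 z a b =
     (\<Sum>k. Gamma_vec (of_nat k \<cdot>\<^sub>v ones_vec (dim_vec a) + a + ones_vec (dim_vec a)) *
          rGamma_vec (of_nat k \<cdot>\<^sub>v ones_vec (dim_vec b) + b + ones_vec (dim_vec b)) * z ^ k)"

definition w :: "cvec \<Rightarrow> cvec \<Rightarrow> cvec \<Rightarrow> nat \<Rightarrow> nat \<Rightarrow> complex \<Rightarrow> complex" where
  "w a b \<kappa> j i z =
     f0 z (a + (\<kappa> $ i) \<cdot>\<^sub>v ones_vec (dim_vec a))
          (b + (\<kappa> $ i) \<cdot>\<^sub>v ones_vec (dim_vec b) + unit_vec (dim_vec b) j)"

end

theory Submission
  imports Defs
begin

text \<open>
  The coefficients of \<open>w\<close> satisfy a first-order recurrence whose quotient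
  \<open>\<Prod>\<^sub>\<rho> (k + \<alpha>\<^sub>\<rho>) / \<Prod>\<^sub>h (k + \<beta>\<^sub>h)\<close> tends to 0 because \<open>r < q\<close>, so the series converges everywhere by
  the ratio test. The contour integrals are Cauchy's formula for the Taylor coefficients.
\<close>

lemma filterlim_of_nat_plus_at_infinity:
  "filterlim (\<lambda>k. of_nat k + (c :: complex)) at_infinity sequentially"
  using tendsto_add_filterlim_at_infinity[OF tendsto_const tendsto_of_nat, of c]
  by (simp add: add.commute)

lemma tendsto_of_nat_plus_quotient:
  "(\<lambda>k. (of_nat k + x) / (of_nat k + y :: complex)) \<longlonglongrightarrow> 1"
proof -
  have "(\<lambda>k. 1 + (x - y) / (of_nat k + y)) \<longlonglongrightarrow> 1 + 0"
    by (intro tendsto_add tendsto_const tendsto_divide_0[OF tendsto_const]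
          filterlim_of_nat_plus_at_infinity)
  moreover have "\<forall>\<^sub>F k in sequentially. of_nat k + y \<noteq> 0"
    using filterlim_of_nat_plus_at_infinity[of y]
    by (rule filterlim_at_infinity_imp_eventually_ne)
  hence "\<forall>\<^sub>F k in sequentially. 1 + (x - y) / (of_nat k + y) = (of_nat k + x) / (of_nat k + y)"
    by eventually_elim (simp add: field_simps)
  ultimately show ?thesis
    by (simp add: tendsto_cong)
qed

text \<open>Each of the \<open>r\<close> numerator factors is paired with a denominator factor, and
  each such quotient tends to 1. The \<open>q - r\<close> denominator factors left over have
  reciprocals tending to 0, and \<open>r < q\<close> guarantees at least one of them.\<close>

lemma prod_quotient_tendsto_0:
  fixes \<alpha> \<beta> :: "nat \<Rightarrow> complex"
  assumes "r < q"
  shows "(\<lambda>k. (\<Prod>h<r. of_nat k + \<alpha> h) / (\<Prod>h<q. of_nat k + \<beta> h)) \<longlonglongrightarrow> 0"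
proof -
  have split: "{..<q} = {..<r} \<union> {r..<q}"
    using assms by auto
  have "(\<lambda>k. (\<Prod>h<r. (of_nat k + \<alpha> h) / (of_nat k + \<beta> h)) * (\<Prod>h\<in>{r..<q}. 1 / (of_nat k + \<beta> h)))
          \<longlonglongrightarrow> (\<Prod>h<r. 1) * (\<Prod>h\<in>{r..<q}. 0)"
    by (intro tendsto_mult tendsto_prod tendsto_of_nat_plus_quotient
          tendsto_divide_0[OF tendsto_const] filterlim_of_nat_plus_at_infinity)
  also have "(\<Prod>h<r. 1) * (\<Prod>h\<in>{r..<q}. 0) = (0 :: complex)"
    using assms by simp
  also have "(\<lambda>k. (\<Prod>h<r. (of_nat k + \<alpha> h) / (of_nat k + \<beta> h)) * (\<Prod>h\<in>{r..<q}. 1 / (of_nat k + \<beta> h)))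
      = (\<lambda>k. (\<Prod>h<r. of_nat k + \<alpha> h) / (\<Prod>h<q. of_nat k + \<beta> h))"
    by (subst split, subst prod.union_disjoint) (auto simp: prod_dividef)
  finally show ?thesis .
qed

text \<open>A ratio test phrased as a recurrence rather than through \<open>c (Suc k) / c k\<close>,
  so that coefficients may vanish. This matters because \<open>rGamma\<close> has zeros.\<close>

lemma summable_quotient_tendsto_0:
  fixes c :: "nat \<Rightarrow> 'a :: {real_normed_field, banach}"
  assumes rec: "\<forall>\<^sub>F k in sequentially. c (Suc k) = \<rho> k * c k"
    and lim: "\<rho> \<longlonglongrightarrow> 0"
  shows "summable (\<lambda>k. c k * z ^ k)"
proof -
  have "(\<lambda>k. \<rho> k * z) \<longlonglongrightarrow> 0 * z"
    by (intro tendsto_mult lim tendsto_const)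
  hence "(\<lambda>k. norm (\<rho> k * z)) \<longlonglongrightarrow> 0"
    by (simp add: tendsto_norm_zero)
  \<comment> \<open>Any constant strictly between 0 and 1 would serve as the ratio here.\<close>
  hence "\<forall>\<^sub>F k in sequentially. norm (\<rho> k * z) < 1 / 2"
    by (rule order_tendstoD) simp
  with rec have "\<forall>\<^sub>F k in sequentially.
      norm (c (Suc k) * z ^ Suc k) \<le> 1 / 2 * norm (c k * z ^ k)"
  proof eventually_elim
    case (elim k)
    have "c (Suc k) * z ^ Suc k = (\<rho> k * z) * (c k * z ^ k)"
      using elim(1) by simp
    thus ?case
      using elim(2) by (metis less_imp_le mult_right_mono norm_ge_zero norm_mult)
  qed
  then obtain N where "\<And>k. k \<ge> N \<Longrightarrow> norm (c (Suc k) * z ^ Suc k) \<le> 1 / 2 * norm (c k * z ^ k)"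
    by (auto simp: eventually_sequentially)
  thus ?thesis
    by (intro summable_ratio_test[of "1 / 2" N]) auto
qed

text \<open>The functional equations of \<open>Gamma\<close> and \<open>rGamma\<close> turn the step
  from \<open>k\<close> to \<open>k + 1\<close> into multiplication by the rational quotient. The
  condition on \<alpha> keeps every \<open>Gamma\<close> argument away from the poles.\<close>

lemma summable_Gamma_rGamma_series:
  fixes \<alpha> \<beta> :: "nat \<Rightarrow> complex"
  assumes "r < q" and \<alpha>: "\<And>h. h < r \<Longrightarrow> \<alpha> h \<notin> \<int>\<^sub>\<le>\<^sub>0"
  shows "summable (\<lambda>k. (\<Prod>h<r. Gamma (of_nat k + \<alpha> h)) * (\<Prod>h<q. rGamma (of_nat k + \<beta> h)) * z ^ k)"
proof (rule summable_quotient_tendsto_0[OF _ prod_quotient_tendsto_0[OF \<open>r < q\<close>, of \<alpha> \<beta>]])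
  \<comment> \<open>If \<open>of_nat k + \<beta> h = 0\<close>, then \<open>rGamma\<close> vanishes
    at this point but equals 1 at the next one, so the divided form of the recurrence can fail. Each
    \<open>h\<close> excludes at most one \<open>k\<close>.\<close>
  have "\<forall>\<^sub>F k in sequentially. \<forall>h\<in>{..<q}. of_nat k + \<beta> h \<noteq> 0"
    using filterlim_of_nat_plus_at_infinity
    by (intro eventually_ball_finite ballI filterlim_at_infinity_imp_eventually_ne) auto
  thus "\<forall>\<^sub>F k in sequentially.
      (\<Prod>h<r. Gamma (of_nat (Suc k) + \<alpha> h)) * (\<Prod>h<q. rGamma (of_nat (Suc k) + \<beta> h)) =
      (\<Prod>h<r. of_nat k + \<alpha> h) / (\<Prod>h<q. of_nat k + \<beta> h) *
      ((\<Prod>h<r. Gamma (of_nat k + \<alpha> h)) * (\<Prod>h<q. rGamma (of_nat k + \<beta> h)))"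
  proof eventually_elim
    case (elim k)
    have num: "Gamma (of_nat (Suc k) + \<alpha> h) = (of_nat k + \<alpha> h) * Gamma (of_nat k + \<alpha> h)"
      if "h < r" for h
    proof -
      \<comment> \<open>Subtracting \<open>k\<close> from a non-positive integer gives another one,
        so a pole at a shifted argument would force one at \<open>\<alpha> h\<close> itself.\<close>
      have "of_nat k + \<alpha> h \<notin> \<int>\<^sub>\<le>\<^sub>0"
      proof
        assume "of_nat k + \<alpha> h \<in> \<int>\<^sub>\<le>\<^sub>0"
        then obtain n where "of_nat k + \<alpha> h = - of_nat n"
          by (auto elim: nonpos_Ints_cases')
        hence "\<alpha> h = - of_nat (n + k)"
          by (simp add: algebra_simps eq_neg_iff_add_eq_0)
        thus False
          using \<alpha>[OF that] by (metis minus_of_nat_in_nonpos_Ints)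
      qed
      thus ?thesis
        using Gamma_plus1[of "of_nat k + \<alpha> h"] by (simp add: add_ac)
    qed
    have den: "rGamma (of_nat (Suc k) + \<beta> h) = rGamma (of_nat k + \<beta> h) / (of_nat k + \<beta> h)"
      if "h < q" for h
      using rGamma_plus1[of "of_nat k + \<beta> h"] elim that by (simp add: field_simps add_ac)
    show ?case
      by (simp add: num den prod.distrib prod_dividef del: of_nat_Suc)
  qed
qed

text \<open>\<open>power_series_holomorphic\<close> speaks of balls of finite radius, so the plane
  is exhausted by balls of integer radius.\<close>

lemma holomorphic_on_UNIV_power_series:
  assumes "\<And>z :: complex. (\<lambda>n. c n * z ^ n) sums f z"
  shows "f holomorphic_on UNIV"
proof -
  have "f holomorphic_on (\<Union>n :: nat. ball 0 (real n))"
    using assms by (intro holomorphic_on_UN_open power_series_holomorphic[of 0 _ c]) auto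
  moreover have "(\<Union>n :: nat. ball (0 :: complex) (real n)) = UNIV"
    by (auto intro: reals_Archimedean2)
  ultimately show ?thesis
    by simp
qed

text \<open>Uniqueness of the expansion at 0 identifies \<open>c n\<close> with the Taylor
  coefficient of \<open>f\<close>. Cauchy's formula for higher derivatives then gives the integral
  on any circle about 0, as \<open>f\<close> is entire.\<close>

lemma has_contour_integral_power_series_coeff:
  assumes sums: "\<And>z :: complex. (\<lambda>n. c n * z ^ n) sums f z" and "R > 0"
  shows "((\<lambda>z. f z / z ^ Suc n) has_contour_integral 2 * of_real pi * \<i> * c n) (circlepath 0 R)"
proof -
  have hol: "f holomorphic_on A" for A
    using holomorphic_on_UNIV_power_series[OF sums] holomorphic_on_subset by blast
  have "f has_fps_expansion Abs_fps c"
    using sums by (intro has_fps_expansionI always_eventually) simp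
  hence "c n = (deriv ^^ n) f 0 / fact n"
    using fps_nth_fps_expansion by fastforce
  thus ?thesis
    using Cauchy_has_contour_integral_higher_derivative_circlepath[of 0 R f 0 n]
      hol \<open>R > 0\<close> by (simp add: holomorphic_on_imp_continuous_on)
qed

theorem proposition3p3:
  fixes p q r :: nat and a b \<kappa> :: cvec
  assumes "p \<ge> 1" and "q \<ge> 1" and "r < q"
    and "a \<in> carrier_vec r" and "b \<in> carrier_vec q" and "\<kappa> \<in> carrier_vec p"
    and "regular_params a b \<kappa>"
    and "\<forall>i<p. \<forall>\<rho><r. \<kappa> $ i + a $ \<rho> + 1 \<notin> \<int>\<^sub>\<le>\<^sub>0"
  shows "\<forall>j<q. \<forall>i<p.
     (\<forall>z. (\<lambda>k. Gamma_vec ((of_nat k + \<kappa> $ i) \<cdot>\<^sub>v ones_vec r + a + ones_vec r) *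
               rGamma_vec ((of_nat k + \<kappa> $ i) \<cdot>\<^sub>v ones_vec q + b + unit_vec q j + ones_vec q) * z ^ k)
          sums w a b \<kappa> j i z) \<and>
     w a b \<kappa> j i holomorphic_on UNIV \<and>
     (\<forall>s::int. s \<ge> 1 \<longrightarrow>
        ((\<lambda>z. z powi (- s) * w a b \<kappa> j i z / (2 * of_real pi * \<i>)) has_contour_integral
           Gamma_vec ((of_int s + \<kappa> $ i) \<cdot>\<^sub>v ones_vec r + a) *
           rGamma_vec ((of_int s + \<kappa> $ i) \<cdot>\<^sub>v ones_vec q + b + unit_vec q j))
          (circlepath 0 1))"
proof (intro allI impI)
  fix j i assume ji: "j < q" "i < p"
  define c where "c = (\<lambda>k. Gamma_vec ((of_nat k + \<kappa> $ i) \<cdot>\<^sub>v ones_vec r + a + ones_vec r) *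
    rGamma_vec ((of_nat k + \<kappa> $ i) \<cdot>\<^sub>v ones_vec q + b + unit_vec q j + ones_vec q))"
  have dims [simp]: "dim_vec a = r" "dim_vec b = q"
    using assms by auto
  \<comment> \<open>Entrywise, \<open>\<kappa> $ i\<close>, the unit vector and the all-ones vector
    become constant shifts. The shifts in \<open>Gamma\<close> are exactly the numbers that the
    hypothesis keeps away from the poles.\<close>
  have "c k = (\<Prod>h<r. Gamma (of_nat k + (\<kappa> $ i + a $ h + 1))) *
      (\<Prod>h<q. rGamma (of_nat k + (\<kappa> $ i + b $ h + unit_vec q j $ h + 1)))" for k
    by (simp add: c_def Gamma_vec_def rGamma_vec_def ones_vec_def add_ac)
  hence "summable (\<lambda>k. c k * z ^ k)" for z
    using summable_Gamma_rGamma_series[OF \<open>r < q\<close>, of "\<lambda>h. \<kappa> $ i + a $ h + 1"] assms(8) ji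
    by simp
  moreover have "w a b \<kappa> j i z = (\<Sum>k. c k * z ^ k)" for z
    by (simp add: w_def f0_def c_def Gamma_vec_def rGamma_vec_def ones_vec_def add_ac)
  ultimately have sums: "(\<lambda>k. c k * z ^ k) sums w a b \<kappa> j i z" for z
    by (simp add: summable_sums)
  have "((\<lambda>z. z powi (- s) * w a b \<kappa> j i z / (2 * of_real pi * \<i>)) has_contour_integral
           Gamma_vec ((of_int s + \<kappa> $ i) \<cdot>\<^sub>v ones_vec r + a) *
           rGamma_vec ((of_int s + \<kappa> $ i) \<cdot>\<^sub>v ones_vec q + b + unit_vec q j))
          (circlepath 0 1)" if "s \<ge> 1" for s :: int
  proof -
    \<comment> \<open>The factor \<open>z powi (- s)\<close> extracts the coefficient with index
      \<open>s - 1\<close>.\<close>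
    define n where "n = nat (s - 1)"
    have s: "s = int (Suc n)"
      using that by (simp add: n_def)
    have "((\<lambda>z. w a b \<kappa> j i z / z ^ Suc n / (2 * of_real pi * \<i>)) has_contour_integral
        2 * of_real pi * \<i> * c n / (2 * of_real pi * \<i>)) (circlepath 0 1)"
      by (intro has_contour_integral_div has_contour_integral_power_series_coeff sums) simp
    \<comment> \<open>This also holds at \<open>z = 0\<close>, where both sides are 0, so the two
      integrands below agree as functions and not just on the circle.\<close>
    moreover have "z powi (- s) = inverse (z ^ Suc n)" for z :: complex
      unfolding s by (simp only: power_int_minus power_int_of_nat)
    hence "(\<lambda>z. w a b \<kappa> j i z / z ^ Suc n / (2 * of_real pi * \<i>)) =
        (\<lambda>z. z powi (- s) * w a b \<kappa> j i z / (2 * of_real pi * \<i>))"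
      by (simp add: field_simps)
    \<comment> \<open>The shift by the all-ones vectors in \<open>c n\<close> turns \<open>n\<close>
      into \<open>n + 1 = s\<close>, which is why no such vector remains on the right.\<close>
    moreover have "2 * of_real pi * \<i> * c n / (2 * of_real pi * \<i>) =
        Gamma_vec ((of_int s + \<kappa> $ i) \<cdot>\<^sub>v ones_vec r + a) *
        rGamma_vec ((of_int s + \<kappa> $ i) \<cdot>\<^sub>v ones_vec q + b + unit_vec q j)"
      by (simp add: c_def s Gamma_vec_def rGamma_vec_def ones_vec_def add_ac)
    ultimately show ?thesis
      by simp
  qed
  with sums holomorphic_on_UNIV_power_series[OF sums]
  show "(\<forall>z. (\<lambda>k. Gamma_vec ((of_nat k + \<kappa> $ i) \<cdot>\<^sub>v ones_vec r + a + ones_vec r) *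
               rGamma_vec ((of_nat k + \<kappa> $ i) \<cdot>\<^sub>v ones_vec q + b + unit_vec q j + ones_vec q) * z ^ k)
          sums w a b \<kappa> j i z) \<and>
     w a b \<kappa> j i holomorphic_on UNIV \<and>
     (\<forall>s::int. s \<ge> 1 \<longrightarrow>
        ((\<lambda>z. z powi (- s) * w a b \<kappa> j i z / (2 * of_real pi * \<i>)) has_contour_integral
           Gamma_vec ((of_int s + \<kappa> $ i) \<cdot>\<^sub>v ones_vec r + a) *
           rGamma_vec ((of_int s + \<kappa> $ i) \<cdot>\<^sub>v ones_vec q + b + unit_vec q j))
          (circlepath 0 1))"
    by (simp add: c_def)
qed

end
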